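(* Let $\{x_k\}$ be a sequence generated by the Linear Contracting PPA (defined in the context) with $\eta\in(0,1)$ and $\beta>0$. Then $\{x_k\}$ converges weakly to a solution of the inclusion $0\in Tx$.
   Context: $\mathcal H$ is a real Hilbert space with inner product $\langle\cdot,\cdot\rangle$ and norm $\|\cdot\|$. $T$ is a (set-valued) maximally monotone operator on $\mathcal H$ such that $T^{-1}(0)=\{x:0\in Tx\}$ is nonempty and bounded. For $\lambda>0$, $J_{\lambda T}=(I+\lambda T)^{-1}$ and $T_\lambda=\frac1\lambda(I-J_{\lambda T})$ is the (single-valued) Yosida regularization. Linear Contracting PPA: given $\tau\in(0,1)$, $x_{-1}=x_0\in\mathcal H$, set for $k\ge0$ $$v_k=\frac1\tau x_k-\frac{1-\tau}{\tau}x_{k-1}.$$ Given $\lambda>0$, $\eta\in(0,1]$, $\beta\ge0$, $\delta_k\ge0$ with $\sum_{k\ge0}\delta_k<+\infty$, for $k=0,1,\dots$ find $x_{k+1}$ such that $$0=\frac{1}{(1-\eta\tau)^{k+1}}T_\lambda(x_{k+1})-\frac{1-\tau}{(1-\eta\tau)^{k+1}}T_\lambda(x_k)+(v_{k+1}-v_k)+\beta(x_{k+1}-x_k)+g_k,$$ where $g_k\in\mathcal H$ satisfies $\|g_k\|\le\delta_k$. *)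

theory Defs
  imports "HOL-Analysis.Analysis"
begin

definition monotone_operator :: "('a::real_inner \<Rightarrow> 'a set) \<Rightarrow> bool" where
  "monotone_operator T \<longleftrightarrow>
     (\<forall>x y. \<forall>u\<in>T x. \<forall>v\<in>T y. 0 \<le> (x - y) \<bullet> (u - v))"

definition maximally_monotone :: "('a::real_inner \<Rightarrow> 'a set) \<Rightarrow> bool" where
  "maximally_monotone T \<longleftrightarrow> monotone_operator T \<and>
     (\<forall>S. monotone_operator S \<and> (\<forall>x. T x \<subseteq> S x) \<longrightarrow> S = T)"

definition inverse_operator :: "('a \<Rightarrow> 'b set) \<Rightarrow> 'b \<Rightarrow> 'a set" where
  "inverse_operator S y = {x. y \<in> S x}"

text \<open>For a maximally monotone T on a Hilbert space and c > 0 the set (I + c T)^{-1}(x)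
  is a singleton for every x (Minty), and the resolvent is its unique element.
  For other T or c the value may be unspecified.\<close>

definition resolvent :: "real \<Rightarrow> ('a::real_inner \<Rightarrow> 'a set) \<Rightarrow> 'a \<Rightarrow> 'a" where
  "resolvent c T x = the_elem (inverse_operator (\<lambda>y. {y + c *\<^sub>R u |u. u \<in> T y}) x)"

definition yosida :: "real \<Rightarrow> ('a::real_inner \<Rightarrow> 'a set) \<Rightarrow> 'a \<Rightarrow> 'a" where
  "yosida c T x = (1 / c) *\<^sub>R (x - resolvent c T x)"

text \<open>The case k = 0 encodes the convention that the iterate with index -1 equals x 0.\<close>

definition ppa_v :: "real \<Rightarrow> (nat \<Rightarrow> 'a::real_vector) \<Rightarrow> nat \<Rightarrow> 'a" where
  "ppa_v \<tau> x k =
     (1 / \<tau>) *\<^sub>R x k - ((1 - \<tau>) / \<tau>) *\<^sub>R (if k = 0 then x 0 else x (k - 1))"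

definition linear_contracting_ppa ::
  "('a::real_inner \<Rightarrow> 'a set) \<Rightarrow> real \<Rightarrow> real \<Rightarrow> real \<Rightarrow> real \<Rightarrow> (nat \<Rightarrow> real)
     \<Rightarrow> (nat \<Rightarrow> 'a) \<Rightarrow> (nat \<Rightarrow> 'a) \<Rightarrow> bool" where
  "linear_contracting_ppa T c \<tau> \<eta> \<beta> \<delta> g x \<longleftrightarrow>
     (\<forall>k. norm (g k) \<le> \<delta> k \<and>
        0 = (1 / (1 - \<eta> * \<tau>) ^ (k + 1)) *\<^sub>R yosida c T (x (k + 1))
            - ((1 - \<tau>) / (1 - \<eta> * \<tau>) ^ (k + 1)) *\<^sub>R yosida c T (x k)
            + (ppa_v \<tau> x (k + 1) - ppa_v \<tau> x k)
            + \<beta> *\<^sub>R (x (k + 1) - x k) + g k)"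

definition weakly_converges_to :: "(nat \<Rightarrow> 'a::real_inner) \<Rightarrow> 'a \<Rightarrow> bool" where
  "weakly_converges_to x l \<longleftrightarrow> (\<forall>y. (\<lambda>k. x k \<bullet> y) \<longlonglongrightarrow> l \<bullet> y)"

end

theory Submission imports Defs begin

text \<open>
Write A for the Yosida regularization of T, J for the resolvent, a k = A (x k) and
r = 1 - \<eta> \<tau>. The zeros of T, the zeros of A and the fixed points of J are the same
points, A is c-cocoercive, and J is nonexpansive.

Fix a zero z and pair the defining equation of the iteration with v (k+1) - z. Since
v (k+1) = x (k+1) + ((1 - \<tau>)/\<tau>) (x (k+1) - x k), the terms containing the mixed product
of a k with x (k+1) - x k cancel, and up to nonnegative terms what is left
(\<open>contracting_step_energy\<close>) is a decrease of
  E k = \<langle>a k, x k - z\<rangle> / r^k + \<parallel>v k - z\<parallel>^2 / 2 + (\<beta>/2) \<parallel>x k - z\<parallel>^2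
by a multiple of its first term plus a multiple of the squared step length. The first term
decreases because \<eta> < 1 makes the factor (1 - \<tau>)/r smaller than 1; the step length is
controlled because \<beta> > 0. The error g k perturbs the decrease by at most a summable
multiple of the square root of the next energy, which leaves E convergent and the decrements
tending to 0 (\<open>perturbed_descent\<close>). Hence a k and the steps tend to 0, v k - x k tends to 0,
and the convergence of E k becomes convergence of the distance of x k to z
(\<open>contracting_ppa_fejer\<close>).

An Opial argument (\<open>weak_convergence_to_fixed_point\<close>) turns this into weak convergence: the
distances to all fixed points of J converge and x k - J (x k) = c a k tends to 0. Instead of
weak cluster points the argument uses asymptotic centers, the minimizers of the limsup of the
squared distance to the sequence. A nonexpansive map fixes the asymptotic center of each of
its approximate fixed point sequences, so no weak compactness enters.

That J is defined on the whole space is Minty's theorem. It is obtained by minimizing the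
Fitzpatrick function of T plus half the squared norm on the product space. This minimization
and the existence of asymptotic centers are two instances of one fact, that a closed,
uniformly convex epigraph that is bounded below has a lowest point (\<open>uniformly_convex_epigraph_minimum\<close>).
\<close>

section \<open>Minimizing uniformly convex functions\<close>


text \<open>Almost minimal points are close to each other, because the midpoint of two of them would
otherwise fall below the infimum; so a minimizing sequence is Cauchy. Speaking of epigraphs
instead of functions covers functions that take the value \<infinity>, and functions given only by
their upper bounds, such as a limsup.\<close>

lemma uniformly_convex_epigraph_minimum:
  fixes E :: "('b::{real_normed_vector, complete_space} \<times> real) set"
  assumes "closed E" and "E \<noteq> {}" and "0 < \<kappa>"
    and lower: "\<And>y t. (y, t) \<in> E \<Longrightarrow> b \<le> t"
    and mid: "\<And>y s z t. (y, s) \<in> E \<Longrightarrow> (z, t) \<in> E \<Longrightarrow>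
      ((1/2) *\<^sub>R (y + z), (s + t) / 2 - \<kappa> * (norm (y - z))\<^sup>2) \<in> E"
  obtains w m where "(w, m) \<in> E" and "\<And>y t. (y, t) \<in> E \<Longrightarrow> m \<le> t"
    and "\<And>y. (y, m) \<in> E \<Longrightarrow> y = w"
proof -
  define m where "m = Inf (snd ` E)"
  have bdd: "bdd_below (snd ` E)"
    using lower by (fastforce intro: bdd_belowI)
  have m_le: "m \<le> t" if "(y, t) \<in> E" for y t
    unfolding m_def using that bdd by (metis cInf_lower image_eqI snd_conv)
  have "\<exists>p\<in>E. snd p < m + inverse (real (Suc n))" for n
  proof -
    have "Inf (snd ` E) < m + inverse (real (Suc n))"
      by (simp add: m_def)
    then show ?thesis
      using cInf_lessD[of "snd ` E"] \<open>E \<noteq> {}\<close> by auto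
  qed
  then obtain p where p: "\<And>n. p n \<in> E" "\<And>n. snd (p n) < m + inverse (real (Suc n))"
    by metis
  define y t where "y n = fst (p n)" and "t n = snd (p n)" for n
  have yt: "(y n, t n) \<in> E" and t_less: "t n < m + inverse (real (Suc n))" for n
    using p by (simp_all add: y_def t_def)
  have gap: "\<kappa> * (norm (y i - z))\<^sup>2 \<le> (t i + s) / 2 - m" if "(z, s) \<in> E" for i z s
    using m_le[OF mid[OF yt[of i] that]] by simp
  have "Cauchy y"
  proof (rule CauchyI)
    fix e :: real assume "0 < e"
    then have "0 < \<kappa> * e\<^sup>2" using \<open>0 < \<kappa>\<close> by simp
    then obtain N where N: "inverse (real (Suc N)) < \<kappa> * e\<^sup>2"
      using reals_Archimedean by blast
    have "norm (y i - y j) < e" if "N \<le> i" "N \<le> j" for i j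
    proof -
      have "inverse (real (Suc n)) < \<kappa> * e\<^sup>2" if "N \<le> n" for n
      proof -
        have "inverse (real (Suc n)) \<le> inverse (real (Suc N))"
          using that by (simp add: le_imp_inverse_le)
        then show ?thesis using N by (rule le_less_trans)
      qed
      then have "t n < m + \<kappa> * e\<^sup>2" if "N \<le> n" for n
        using that t_less[of n] by (meson add_strict_left_mono less_trans)
      from this[OF \<open>N \<le> i\<close>] this[OF \<open>N \<le> j\<close>]
      have "\<kappa> * (norm (y i - y j))\<^sup>2 < \<kappa> * e\<^sup>2"
        using gap[OF yt, of i j] by (simp add: field_simps)
      then have "(norm (y i - y j))\<^sup>2 < e\<^sup>2"
        using \<open>0 < \<kappa>\<close> by simp
      then show ?thesis using \<open>0 < e\<close> by (simp add: power2_less_imp_less)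
    qed
    then show "\<exists>M. \<forall>i\<ge>M. \<forall>j\<ge>M. norm (y i - y j) < e" by blast
  qed
  then obtain w where w: "y \<longlonglongrightarrow> w"
    using Cauchy_convergent convergent_def by blast
  have "t \<longlonglongrightarrow> m"
  proof (rule tendsto_sandwich)
    show "\<forall>\<^sub>F n in sequentially. m \<le> t n" using m_le[OF yt] by simp
    show "\<forall>\<^sub>F n in sequentially. t n \<le> m + inverse (real (Suc n))"
      using t_less by (simp add: less_imp_le)
    show "(\<lambda>n. m + inverse (real (Suc n))) \<longlonglongrightarrow> m"
      using LIMSEQ_inverse_real_of_nat_add[of m] by simp
  qed simp
  then have "(\<lambda>n. (y n, t n)) \<longlonglongrightarrow> (w, m)"
    using w by (rule tendsto_Pair[rotated])
  then have wm: "(w, m) \<in> E"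
    by (rule closed_sequentially[OF \<open>closed E\<close> yt])
  have "z = w" if "(z, m) \<in> E" for z
    using m_le[OF mid[OF that wm]] \<open>0 < \<kappa>\<close> by (simp add: mult_le_0_iff)
  with wm m_le show thesis using that by blast
qed

lemma norm_midpoint_square:
  fixes a b :: "'b::real_inner"
  shows "(norm ((1/2) *\<^sub>R (a + b)))\<^sup>2
    = ((norm a)\<^sup>2 + (norm b)\<^sup>2) / 2 - (norm (a - b))\<^sup>2 / 4"
  by (simp add: power2_norm_eq_inner inner_commute algebra_simps
      add_divide_distrib diff_divide_distrib)

section \<open>Minty's theorem\<close>

text \<open>Maximality is used pointwise: a pair that is monotonically related to the whole graph
can be adjoined to the graph, and so belongs to it already.\<close>

lemma maximally_monotone_iff:
  "maximally_monotone T \<longleftrightarrow> monotone_operator T \<and>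
     (\<forall>y v. (\<forall>z. \<forall>u\<in>T z. 0 \<le> (y - z) \<bullet> (v - u)) \<longrightarrow> v \<in> T y)"
proof (intro iffI conjI allI impI)
  assume T: "maximally_monotone T"
  then show mono: "monotone_operator T" by (simp add: maximally_monotone_def)
  fix y v assume yv: "\<forall>z. \<forall>u\<in>T z. 0 \<le> (y - z) \<bullet> (v - u)"
  define S where "S = T(y := insert v (T y))"
  have sym: "(a - b) \<bullet> (r - s) = (b - a) \<bullet> (s - r)" for a b r s :: 'a
    by (simp add: algebra_simps)
  have "monotone_operator S"
    unfolding monotone_operator_def
  proof (intro allI ballI)
    fix a b r s assume "r \<in> S a" "s \<in> S b"
    then have "r \<in> T a \<or> a = y \<and> r = v" "s \<in> T b \<or> b = y \<and> s = v"
      by (auto simp: S_def split: if_splits)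
    then show "0 \<le> (a - b) \<bullet> (r - s)"
      using mono yv unfolding monotone_operator_def
      by (metis sym diff_self inner_zero_left order_refl)
  qed
  moreover have "\<forall>z. T z \<subseteq> S z" by (auto simp: S_def)
  ultimately have "S = T" using T by (simp add: maximally_monotone_def)
  then show "v \<in> T y" by (metis S_def fun_upd_same insertI1)
next
  assume T: "monotone_operator T \<and>
     (\<forall>y v. (\<forall>z. \<forall>u\<in>T z. 0 \<le> (y - z) \<bullet> (v - u)) \<longrightarrow> v \<in> T y)"
  have "S = T" if S: "monotone_operator S" "\<forall>x. T x \<subseteq> S x" for S
  proof (rule ext, rule equalityI)
    fix x
    show "S x \<subseteq> T x"
    proof
      fix v assume "v \<in> S x"
      then have "\<forall>z. \<forall>u\<in>T z. 0 \<le> (x - z) \<bullet> (v - u)"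
        using S unfolding monotone_operator_def by blast
      then show "v \<in> T x" using T by blast
    qed
  qed (use S in blast)
  then show "maximally_monotone T" using T by (auto simp: maximally_monotone_def)
qed

lemma nonneg_of_small_perturbation:
  fixes A B :: real
  assumes "\<And>s. 0 < s \<Longrightarrow> s < 1 \<Longrightarrow> 0 \<le> A + s * B"
  shows "0 \<le> A"
proof -
  have "((\<lambda>s. A + s * B) \<longlongrightarrow> A + 0 * B) (at_right 0)"
    by (intro tendsto_intros)
  moreover have "\<forall>\<^sub>F s in at_right 0. 0 \<le> A + s * B"
    using eventually_at_right_less[of "0::real"] 
    by (auto simp: eventually_at_right_field intro!: exI[of _ 1] assms)
  ultimately show ?thesis
    using tendsto_lowerbound by fastforce
qed

text \<open>Let \<phi> (x, v) be the supremum of \<langle>x, u\<rangle> + \<langle>z, v\<rangle> - \<langle>z, u\<rangle> over the pairs (z, u) of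
the graph of T (the Fitzpatrick function). Maximality gives \<phi> (x, v) \<ge> \<langle>x, v\<rangle>, and monotonicity
gives equality on the graph. The sum of \<phi> and half the squared norm is therefore nonnegative
and uniformly convex. Comparing its minimizer (x0, u0) with the points of the graph shows that
(- u0, - x0) is monotonically related to the graph, so it lies in the graph; comparing once
more, with this very point, gives x0 = - u0.\<close>

lemma minty_at_zero:
  fixes T :: "'a::{real_inner, complete_space} \<Rightarrow> 'a set"
  assumes "maximally_monotone T"
  shows "\<exists>y. - y \<in> T y"
proof -
  have mono: "0 \<le> (y - z) \<bullet> (v - u)" if "v \<in> T y" "u \<in> T z" for y z u v
    using assms that by (auto simp: maximally_monotone_def monotone_operator_def)
  have max: "v \<in> T y" if "\<And>z u. u \<in> T z \<Longrightarrow> 0 \<le> (y - z) \<bullet> (v - u)" for y v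
    using assms that unfolding maximally_monotone_iff by blast
  \<comment> \<open>The epigraph of the sum of the Fitzpatrick function and half the squared norm.\<close>
  define E where "E = {p :: ('a \<times> 'a) \<times> real. \<forall>z u. u \<in> T z \<longrightarrow>
    fst (fst p) \<bullet> u + z \<bullet> snd (fst p) - z \<bullet> u + (norm (fst p))\<^sup>2 / 2 \<le> snd p}"
  have E_iff: "((x, v), t) \<in> E \<longleftrightarrow> (\<forall>z u. u \<in> T z \<longrightarrow>
      x \<bullet> u + z \<bullet> v - z \<bullet> u + (norm (x, v))\<^sup>2 / 2 \<le> t)" for x v t
    by (simp add: E_def)
  have normP: "(norm (x, v))\<^sup>2 = x \<bullet> x + v \<bullet> v" for x v :: 'a
    by (simp add: norm_Pair power2_norm_eq_inner)
  obtain y0 v0 where y0: "v0 \<in> T y0" using max[of 0 0] by blast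
  have graph_E: "((z, u), z \<bullet> u + (norm (z, u))\<^sup>2 / 2) \<in> E" if "u \<in> T z" for z u
    unfolding E_iff using mono[OF that] by (auto simp: algebra_simps)
  have above_duality: "x \<bullet> v + (norm (x, v))\<^sup>2 / 2 \<le> t" if "((x, v), t) \<in> E" for x v t
  proof (rule ccontr)
    assume *: "\<not> ?thesis"
    have strict: "0 < (x - z) \<bullet> (v - u)" if "u \<in> T z" for z u
      using * that \<open>((x, v), t) \<in> E\<close>[unfolded E_iff, rule_format, OF that]
      by (simp add: algebra_simps)
    then have "v \<in> T x" by (intro max) (rule less_imp_le)
    from strict[OF this] show False by simp
  qed
  have "E = (\<Inter>z. \<Inter>u\<in>T z. {p. fst (fst p) \<bullet> u + z \<bullet> snd (fst p) - z \<bullet> u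
      + (norm (fst p))\<^sup>2 / 2 \<le> snd p})"
    by (auto simp: E_def)
  also have "closed \<dots>"
    by (intro closed_INT ballI closed_Collect_le continuous_intros) auto
  finally have "closed E" .
  moreover have "E \<noteq> {}" using graph_E[OF y0] by blast
  moreover have "(0::real) < 1/8" by simp
  moreover have "0 \<le> t" if "(p, t) \<in> E" for p t
  proof -
    obtain x v where [simp]: "p = (x, v)" by force
    have "0 \<le> (x + v) \<bullet> (x + v) / 2" by simp
    also have "\<dots> = x \<bullet> v + (norm (x, v))\<^sup>2 / 2"
      by (simp add: normP inner_commute algebra_simps)
    also have "\<dots> \<le> t" using above_duality that by simp
    finally show ?thesis .
  qed
  moreover have "((1/2) *\<^sub>R (p + q), (s + t) / 2 - (1/8) * (norm (p - q))\<^sup>2) \<in> E"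
    if "(p, s) \<in> E" "(q, t) \<in> E" for p q s t
    unfolding E_def mem_Collect_eq fst_conv snd_conv
  proof (intro allI impI)
    fix z u assume "u \<in> T z"
    have 1: "fst p \<bullet> u + z \<bullet> snd p - z \<bullet> u + (norm p)\<^sup>2 / 2 \<le> s"
      and 2: "fst q \<bullet> u + z \<bullet> snd q - z \<bullet> u + (norm q)\<^sup>2 / 2 \<le> t"
      using that \<open>u \<in> T z\<close> by (auto simp: E_def)
    show "fst ((1/2) *\<^sub>R (p + q)) \<bullet> u + z \<bullet> snd ((1/2) *\<^sub>R (p + q)) - z \<bullet> u
        + (norm ((1/2) *\<^sub>R (p + q)))\<^sup>2 / 2 \<le> (s + t) / 2 - (1/8) * (norm (p - q))\<^sup>2"
      using 1 2 unfolding norm_midpoint_square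
      by (simp add: algebra_simps add_divide_distrib diff_divide_distrib)
  qed
  ultimately obtain w m where wm: "(w, m) \<in> E" and min: "\<And>p t. (p, t) \<in> E \<Longrightarrow> m \<le> t"
    by (rule uniformly_convex_epigraph_minimum) (assumption | (rule that; blast))+
  obtain x0 u0 where w: "w = (x0, u0)" by force
  have key: "(norm (x0 + u0))\<^sup>2 \<le> (y + u0) \<bullet> (v + x0)" if v: "v \<in> T y" for y v
  proof -
    have wE: "x0 \<bullet> u + z \<bullet> u0 - z \<bullet> u + (x0 \<bullet> x0 + u0 \<bullet> u0) / 2 \<le> m" if "u \<in> T z" for z u
      using wm that unfolding w E_iff normP by blast
    \<comment> \<open>The objective along the segment from (x0, u0) to (y, v) is at most
      m + s A + s^2 B, so minimality at s = 0 forces A to be nonnegative.\<close>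
    define A where "A = y \<bullet> v - m + (x0 \<bullet> x0 + u0 \<bullet> u0) / 2 + x0 \<bullet> (y - x0) + u0 \<bullet> (v - u0)"
    define B where "B = ((y - x0) \<bullet> (y - x0) + (v - u0) \<bullet> (v - u0)) / 2"
    have "0 \<le> A + s * B" if s: "0 < s" "s < 1" for s
    proof -
      \<comment> \<open>An upper bound for the Fitzpatrick function at the minimizer.\<close>
      define h where "h = m - (x0 \<bullet> x0 + u0 \<bullet> u0) / 2"
      define X where "X = x0 + s *\<^sub>R (y - x0)"
      define V where "V = u0 + s *\<^sub>R (v - u0)"
      define t where "t = (1 - s) * h + s * (y \<bullet> v) + (norm (X, V))\<^sup>2 / 2"
      have "((X, V), t) \<in> E"
        unfolding E_iff
      proof (intro allI impI)
        fix z u assume u: "u \<in> T z"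
        have "(1 - s) * (x0 \<bullet> u + z \<bullet> u0 - z \<bullet> u) \<le> (1 - s) * h"
          using wE[OF u] s by (intro mult_left_mono) (auto simp: h_def)
        moreover have "s * (y \<bullet> u + z \<bullet> v - z \<bullet> u) \<le> s * (y \<bullet> v)"
          using mono[OF v u] s by (intro mult_left_mono) (auto simp: algebra_simps)
        ultimately show "X \<bullet> u + z \<bullet> V - z \<bullet> u + (norm (X, V))\<^sup>2 / 2 \<le> t"
          by (simp add: t_def X_def V_def algebra_simps)
      qed
      then have "m \<le> t" by (rule min)
      moreover have "t - m = s * (A + s * B)"
        unfolding t_def h_def A_def B_def normP X_def V_def
        by (simp add: algebra_simps inner_commute add_divide_distrib diff_divide_distrib)
      ultimately have "0 \<le> s * (A + s * B)" by linarith
      then show ?thesis using s by (meson not_less order_less_le_trans zero_le_mult_iff)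
    qed
    then have "0 \<le> A" by (rule nonneg_of_small_perturbation)
    moreover have "x0 \<bullet> u0 + (x0 \<bullet> x0 + u0 \<bullet> u0) / 2 \<le> m"
      using above_duality[of x0 u0 m] wm unfolding w normP by simp
    ultimately show ?thesis
      by (simp add: A_def power2_norm_eq_inner algebra_simps inner_commute)
  qed
  have "- x0 \<in> T (- u0)"
  proof (rule max)
    fix z u assume "u \<in> T z"
    have "(- u0 - z) \<bullet> (- x0 - u) = (z + u0) \<bullet> (u + x0)"
      by (simp add: algebra_simps)
    moreover have "0 \<le> (z + u0) \<bullet> (u + x0)"
      by (rule order_trans[OF zero_le_power2 key[OF \<open>u \<in> T z\<close>]])
    ultimately show "0 \<le> (- u0 - z) \<bullet> (- x0 - u)" by simp
  qed
  moreover from key[OF this] have "- u0 = x0" by (simp add: neg_eq_iff_add_eq_0 add.commute)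
  ultimately have "- x0 \<in> T x0" by (simp only:)
  then show ?thesis ..
qed

text \<open>Solving x \<in> y + c T y amounts to solving 0 \<in> y + S y for the operator S y = c T y - x,
and S inherits maximal monotonicity.\<close>

theorem minty:
  fixes T :: "'a::{real_inner, complete_space} \<Rightarrow> 'a set"
  assumes T: "maximally_monotone T" and c: "0 < c"
  obtains y u where "u \<in> T y" and "x = y + c *\<^sub>R u"
proof -
  define S where "S y = {c *\<^sub>R u - x |u. u \<in> T y}" for y
  have scale: "(y - z) \<bullet> ((c *\<^sub>R v - x) - (c *\<^sub>R u - x)) = c * ((y - z) \<bullet> (v - u))" for y z v u
    by (simp add: algebra_simps)
  have "monotone_operator S"
    unfolding monotone_operator_def
  proof (intro allI ballI)
    fix y z p q assume "p \<in> S y" "q \<in> S z"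
    then obtain v u where "v \<in> T y" "u \<in> T z" "p = c *\<^sub>R v - x" "q = c *\<^sub>R u - x"
      by (auto simp: S_def)
    then show "0 \<le> (y - z) \<bullet> (p - q)"
      using scale T c by (simp add: maximally_monotone_def monotone_operator_def)
  qed
  moreover have "p \<in> S y" if p: "\<forall>z. \<forall>q\<in>S z. 0 \<le> (y - z) \<bullet> (p - q)" for y p
  proof -
    define v where "v = (1 / c) *\<^sub>R (p + x)"
    have pv: "p = c *\<^sub>R v - x" using c by (simp add: v_def)
    have "0 \<le> (y - z) \<bullet> (v - u)" if "u \<in> T z" for z u
    proof -
      have "c *\<^sub>R u - x \<in> S z" using that by (auto simp: S_def)
      then have "0 \<le> c * ((y - z) \<bullet> (v - u))" using p scale pv by metis
      then show ?thesis using c by (simp add: zero_le_mult_iff)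
    qed
    then have "v \<in> T y" using T unfolding maximally_monotone_iff by blast
    then show ?thesis using pv by (auto simp: S_def)
  qed
  ultimately have "maximally_monotone S" unfolding maximally_monotone_iff by blast
  then obtain y where "- y \<in> S y" using minty_at_zero by blast
  then obtain u where "u \<in> T y" "- y = c *\<^sub>R u - x" by (auto simp: S_def)
  then show thesis using that[of u y] by (simp add: algebra_simps)
qed

section \<open>Resolvent and Yosida regularization\<close>


lemma resolvent_equation_unique:
  assumes "maximally_monotone T" and "0 < c"
    and "u \<in> T y" "v \<in> T z" and eq: "y + c *\<^sub>R u = z + c *\<^sub>R v"
  shows "y = z"
proof -
  have "0 \<le> (y - z) \<bullet> (u - v)"
    using assms by (simp add: maximally_monotone_def monotone_operator_def)
  then have "0 \<le> (y - z) \<bullet> (c *\<^sub>R u - c *\<^sub>R v)"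
    using \<open>0 < c\<close> by (simp flip: scaleR_diff_right)
  also have "c *\<^sub>R u - c *\<^sub>R v = - (y - z)" using eq by (simp add: algebra_simps)
  finally have "(y - z) \<bullet> (y - z) \<le> 0" unfolding inner_minus_right by linarith
  then show ?thesis by (metis inner_gt_zero_iff not_le right_minus_eq)
qed

lemma resolvent_eq:
  assumes "maximally_monotone T" and "0 < c" and "u \<in> T y"
  shows "resolvent c T (y + c *\<^sub>R u) = y"
proof -
  have "inverse_operator (\<lambda>z. {z + c *\<^sub>R v |v. v \<in> T z}) (y + c *\<^sub>R u) = {y}"
    using assms resolvent_equation_unique[OF assms(1,2,3)]
    by (auto simp: inverse_operator_def)
  then show ?thesis by (simp add: resolvent_def)
qed

lemma yosida_in:
  fixes T :: "'a::{real_inner, complete_space} \<Rightarrow> 'a set"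
  assumes "maximally_monotone T" and "0 < c"
  shows "yosida c T x \<in> T (resolvent c T x)"
proof -
  obtain y u where "u \<in> T y" "x = y + c *\<^sub>R u" using minty[OF assms] by blast
  then show ?thesis using resolvent_eq[OF assms] \<open>0 < c\<close> by (simp add: yosida_def)
qed

lemma resolvent_add_yosida: "0 < c \<Longrightarrow> resolvent c T x + c *\<^sub>R yosida c T x = x"
  by (simp add: yosida_def)

lemma resolvent_fixed_iff:
  fixes T :: "'a::{real_inner, complete_space} \<Rightarrow> 'a set"
  assumes "maximally_monotone T" and "0 < c"
  shows "resolvent c T z = z \<longleftrightarrow> 0 \<in> T z"
  using resolvent_eq[OF assms, of 0 z] yosida_in[OF assms, of z] by (auto simp: yosida_def)

lemma yosida_cocoercive:
  fixes T :: "'a::{real_inner, complete_space} \<Rightarrow> 'a set"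
  assumes "maximally_monotone T" and "0 < c"
  shows "c * (norm (yosida c T x - yosida c T y))\<^sup>2
    \<le> (yosida c T x - yosida c T y) \<bullet> (x - y)"
proof -
  let ?J = "resolvent c T" and ?A = "yosida c T"
  have "0 \<le> (?J x - ?J y) \<bullet> (?A x - ?A y)"
    using assms yosida_in[OF assms]
    by (simp add: maximally_monotone_def monotone_operator_def)
  moreover have "?J x - ?J y = (x - y) - c *\<^sub>R (?A x - ?A y)"
    using resolvent_add_yosida[OF \<open>0 < c\<close>, of T x] resolvent_add_yosida[OF \<open>0 < c\<close>, of T y]
    by (simp add: algebra_simps)
  ultimately have "0 \<le> (x - y) \<bullet> (?A x - ?A y) - c * ((?A x - ?A y) \<bullet> (?A x - ?A y))"
    by (metis inner_diff_left inner_scaleR_left)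
  then show ?thesis
    unfolding power2_norm_eq_inner inner_commute[of _ "x - y"] by linarith
qed

lemma resolvent_nonexpansive:
  fixes T :: "'a::{real_inner, complete_space} \<Rightarrow> 'a set"
  assumes "maximally_monotone T" and "0 < c"
  shows "norm (resolvent c T x - resolvent c T y) \<le> norm (x - y)"
proof -
  let ?d = "x - y" and ?a = "yosida c T x - yosida c T y"
  have J: "resolvent c T x - resolvent c T y = ?d - c *\<^sub>R ?a"
    using resolvent_add_yosida[OF \<open>0 < c\<close>, of T x] resolvent_add_yosida[OF \<open>0 < c\<close>, of T y]
    by (simp add: algebra_simps)
  have "c * (c * (norm ?a)\<^sup>2) \<le> c * (?a \<bullet> ?d)"
    using yosida_cocoercive[OF assms, of x y] \<open>0 < c\<close> by (intro mult_left_mono) auto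
  moreover have "0 \<le> c * (c * (norm ?a)\<^sup>2)" using \<open>0 < c\<close> by simp
  moreover have "(norm (?d - c *\<^sub>R ?a))\<^sup>2
      = (norm ?d)\<^sup>2 - 2 * (c * (?a \<bullet> ?d)) + c * (c * (norm ?a)\<^sup>2)"
    unfolding power2_norm_eq_inner inner_diff_left[of ?d] inner_diff_right[of _ ?d]
    by (simp add: inner_commute)
  ultimately have "(norm (?d - c *\<^sub>R ?a))\<^sup>2 \<le> (norm ?d)\<^sup>2" by linarith
  then show ?thesis unfolding J by (rule power2_le_imp_le) simp
qed

section \<open>Asymptotic centers and weak convergence\<close>

text \<open>For a bounded sequence x this says that the limsup of the squared distances from x k to y
is at most t. The form with \<epsilon> describes a closed epigraph without a limsup in the
extended reals.\<close>

definition limsup_dist_sq_le :: "(nat \<Rightarrow> 'a::real_inner) \<Rightarrow> 'a \<Rightarrow> real \<Rightarrow> bool" where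
  "limsup_dist_sq_le x y t \<longleftrightarrow>
     (\<forall>\<epsilon>>0. \<forall>\<^sub>F k in sequentially. (norm (x k - y))\<^sup>2 \<le> t + \<epsilon>)"

lemma limsup_dist_sq_le_perturb:
  assumes x: "limsup_dist_sq_le x y s" and e: "e \<longlonglongrightarrow> t"
    and le: "\<And>k. (norm (x' k - y'))\<^sup>2 \<le> (norm (x k - y))\<^sup>2 - s + e k"
  shows "limsup_dist_sq_le x' y' t"
  unfolding limsup_dist_sq_le_def
proof (intro allI impI)
  fix \<epsilon> :: real assume "0 < \<epsilon>"
  then have "\<forall>\<^sub>F k in sequentially. (norm (x k - y))\<^sup>2 \<le> s + \<epsilon> / 2"
    using x unfolding limsup_dist_sq_le_def by (meson half_gt_zero)
  moreover have "\<forall>\<^sub>F k in sequentially. e k < t + \<epsilon> / 2"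
    using e \<open>0 < \<epsilon>\<close> by (intro order_tendstoD) auto
  ultimately show "\<forall>\<^sub>F k in sequentially. (norm (x' k - y'))\<^sup>2 \<le> t + \<epsilon>"
  proof eventually_elim
    case (elim k)
    then show ?case using le[of k] by (simp add: field_simps)
  qed
qed

lemma limsup_dist_sq_le_of_tendsto:
  assumes "(\<lambda>k. norm (x k - y)) \<longlonglongrightarrow> l"
  shows "limsup_dist_sq_le x y t \<longleftrightarrow> l\<^sup>2 \<le> t"
proof
  have sq: "(\<lambda>k. (norm (x k - y))\<^sup>2) \<longlonglongrightarrow> l\<^sup>2" using assms by (rule tendsto_power)
  {
    assume "limsup_dist_sq_le x y t"
    then have "l\<^sup>2 \<le> t + \<epsilon>" if "0 < \<epsilon>" for \<epsilon>
      using tendsto_upperbound[OF sq] that by (auto simp: limsup_dist_sq_le_def)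
    then show "l\<^sup>2 \<le> t" by (rule field_le_epsilon)
  next
    assume "l\<^sup>2 \<le> t"
    have "\<forall>\<^sub>F k in sequentially. (norm (x k - y))\<^sup>2 < t + \<epsilon>" if "0 < \<epsilon>" for \<epsilon>
      using \<open>l\<^sup>2 \<le> t\<close> that by (intro order_tendstoD(2)[OF sq]) simp
    then show "limsup_dist_sq_le x y t"
      unfolding limsup_dist_sq_le_def by (blast intro: eventually_mono less_imp_le)
  }
qed

text \<open>For each k the function y \<mapsto> \<parallel>x k - y\<parallel>^2 is uniformly convex with modulus 1/4 at midpoints,
and this survives passing to the limsup; boundedness of x makes the limsup finite and its
epigraph closed.\<close>

lemma asymptotic_center_exists:
  fixes x :: "nat \<Rightarrow> 'a::{real_inner, complete_space}"
  assumes "bounded (range x)"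
  obtains w m where "limsup_dist_sq_le x w m"
    and "\<And>y t. limsup_dist_sq_le x y t \<Longrightarrow> m \<le> t"
    and "\<And>y. limsup_dist_sq_le x y m \<Longrightarrow> y = w"
proof -
  define E where "E = {(y, t). limsup_dist_sq_le x y t}"
  obtain M where M: "\<And>k. norm (x k) \<le> M"
    using assms unfolding bounded_iff by auto
  have "(norm (x k - 0))\<^sup>2 \<le> M\<^sup>2" for k
    using M[of k] by (simp add: power_mono)
  then have "limsup_dist_sq_le x 0 (M\<^sup>2)"
    by (auto simp: limsup_dist_sq_le_def intro!: always_eventually add_increasing2)
  then have "E \<noteq> {}" by (auto simp: E_def)
  have "closed E"
    unfolding closed_sequential_limits
  proof (intro allI impI, elim conjE)
    fix p q assume pE: "\<forall>n. p n \<in> E" and pq: "p \<longlonglongrightarrow> q"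
    obtain y t where q: "q = (y, t)" by force
    define h where "h n = snd (p n) + 2 * (M + norm (fst (p n))) * norm (fst (p n) - y)
      + (norm (fst (p n) - y))\<^sup>2" for n
    have "(\<lambda>n. fst (p n)) \<longlonglongrightarrow> y" "(\<lambda>n. snd (p n)) \<longlonglongrightarrow> t"
      using tendsto_fst[OF pq] tendsto_snd[OF pq] by (simp_all add: q)
    then have "h \<longlonglongrightarrow> t + 2 * (M + norm y) * norm (y - y) + (norm (y - y))\<^sup>2"
      unfolding h_def by (intro tendsto_intros)
    then have h: "h \<longlonglongrightarrow> t" by simp
    have "\<forall>\<^sub>F k in sequentially. (norm (x k - y))\<^sup>2 \<le> t + \<epsilon>" if "0 < \<epsilon>" for \<epsilon>
    proof -
      obtain n where n: "h n < t + \<epsilon> / 2"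
        using order_tendstoD(2)[OF h, of "t + \<epsilon> / 2"] \<open>0 < \<epsilon>\<close>
        by (auto simp: eventually_sequentially)
      let ?z = "fst (p n)"
      have "limsup_dist_sq_le x ?z (snd (p n))"
        using pE by (auto simp: E_def case_prod_beta)
      then have "\<forall>\<^sub>F k in sequentially. (norm (x k - ?z))\<^sup>2 \<le> snd (p n) + \<epsilon> / 2"
        unfolding limsup_dist_sq_le_def using \<open>0 < \<epsilon>\<close> by (meson half_gt_zero)
      then show ?thesis
      proof eventually_elim
        case (elim k)
        have "(norm (x k - y))\<^sup>2 = (norm (x k - ?z))\<^sup>2
            + 2 * ((x k - ?z) \<bullet> (?z - y)) + (norm (?z - y))\<^sup>2"
          by (simp add: power2_norm_eq_inner inner_commute algebra_simps)
        moreover have "(x k - ?z) \<bullet> (?z - y) \<le> norm (x k - ?z) * norm (?z - y)"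
          by (rule norm_cauchy_schwarz)
        moreover have "\<dots> \<le> (M + norm ?z) * norm (?z - y)"
          using M[of k] norm_triangle_ineq4[of "x k" ?z] by (intro mult_right_mono) auto
        ultimately show ?case using elim n by (simp add: h_def field_simps)
      qed
    qed
    then show "q \<in> E" by (simp add: E_def q limsup_dist_sq_le_def)
  qed
  moreover note \<open>E \<noteq> {}\<close>
  moreover have "(0::real) < 1/4" by simp
  moreover have "0 \<le> t" if "(y, t) \<in> E" for y t
  proof (rule field_le_epsilon)
    fix \<epsilon> :: real assume "0 < \<epsilon>"
    then have "\<forall>\<^sub>F k in sequentially. (norm (x k - y))\<^sup>2 \<le> t + \<epsilon>"
      using that by (simp add: E_def limsup_dist_sq_le_def)
    then obtain k where "(norm (x k - y))\<^sup>2 \<le> t + \<epsilon>"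
      by (auto simp: eventually_sequentially)
    then show "0 \<le> t + \<epsilon>" using order_trans zero_le_power2 by blast
  qed
  moreover have "((1/2) *\<^sub>R (y + z), (s + t) / 2 - (1/4) * (norm (y - z))\<^sup>2) \<in> E"
    if "(y, s) \<in> E" "(z, t) \<in> E" for y z s t
  proof -
    have "\<forall>\<^sub>F k in sequentially. (norm (x k - (1/2) *\<^sub>R (y + z)))\<^sup>2
        \<le> (s + t) / 2 - (1/4) * (norm (y - z))\<^sup>2 + \<epsilon>" if "0 < \<epsilon>" for \<epsilon>
    proof -
      have "\<forall>\<^sub>F k in sequentially. (norm (x k - y))\<^sup>2 \<le> s + \<epsilon>"
        "\<forall>\<^sub>F k in sequentially. (norm (x k - z))\<^sup>2 \<le> t + \<epsilon>"
        using \<open>(y, s) \<in> E\<close> \<open>(z, t) \<in> E\<close> \<open>0 < \<epsilon>\<close>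
        by (simp_all add: E_def limsup_dist_sq_le_def)
      then show ?thesis
      proof eventually_elim
        case (elim k)
        have "x k - (1/2) *\<^sub>R (y + z) = (1/2) *\<^sub>R ((x k - y) + (x k - z))"
          by (simp add: algebra_simps flip: scaleR_add_left)
        then show ?case
          using elim norm_midpoint_square[of "x k - y" "x k - z"]
          by (simp add: norm_minus_commute field_simps)
      qed
    qed
    then show ?thesis by (simp add: E_def limsup_dist_sq_le_def)
  qed
  ultimately obtain w m where "(w, m) \<in> E" "\<And>y t. (y, t) \<in> E \<Longrightarrow> m \<le> t"
      "\<And>y. (y, m) \<in> E \<Longrightarrow> y = w"
    by (rule uniformly_convex_epigraph_minimum) (assumption | (rule that; blast))+
  then show thesis
    unfolding E_def mem_Collect_eq prod.case by (rule that)
qed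

text \<open>J w is asymptotically no farther from the sequence than w: x k is close to J (x k), whose
distance to J w is at most that of x k to w. Uniqueness of the center gives J w = w.\<close>

lemma asymptotic_center_fixed:
  fixes x :: "nat \<Rightarrow> 'a::{real_inner, complete_space}"
  assumes nonexp: "\<And>y z. norm (J y - J z) \<le> norm (y - z)"
    and bdd: "bounded (range x)"
    and res: "(\<lambda>k. x k - J (x k)) \<longlonglongrightarrow> 0"
  obtains w m where "J w = w" and "limsup_dist_sq_le x w m"
    and "\<And>y t. limsup_dist_sq_le x y t \<Longrightarrow> m \<le> t"
proof -
  obtain w m where w: "limsup_dist_sq_le x w m"
    and min: "\<And>y t. limsup_dist_sq_le x y t \<Longrightarrow> m \<le> t"
    and unique: "\<And>y. limsup_dist_sq_le x y m \<Longrightarrow> y = w"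
    by (rule asymptotic_center_exists[OF bdd]) (rule that; blast)
  obtain M where M: "\<And>k. norm (x k) \<le> M"
    using bdd unfolding bounded_iff by auto
  define r where "r k = norm (x k - J (x k))" for k
  have r: "r \<longlonglongrightarrow> 0" unfolding r_def using tendsto_norm[OF res] by simp
  have "limsup_dist_sq_le x (J w) m"
  proof (rule limsup_dist_sq_le_perturb[OF w])
    have "(\<lambda>k. m + 2 * (M + norm w) * r k + (r k)\<^sup>2) \<longlonglongrightarrow> m + 2 * (M + norm w) * 0 + 0\<^sup>2"
      using r by (intro tendsto_intros)
    then show "(\<lambda>k. m + 2 * (M + norm w) * r k + (r k)\<^sup>2) \<longlonglongrightarrow> m" by simp
    fix k
    have "norm (x k - J w) \<le> r k + norm (J (x k) - J w)"
      unfolding r_def using norm_triangle_ineq[of "x k - J (x k)" "J (x k) - J w"] by simp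
    also have "\<dots> \<le> r k + norm (x k - w)" using nonexp by simp
    finally have "(norm (x k - J w))\<^sup>2 \<le> (r k + norm (x k - w))\<^sup>2" by (simp add: power_mono)
    moreover have "norm (x k - w) * r k \<le> (M + norm w) * r k"
      using M[of k] norm_triangle_ineq4[of "x k" w] by (intro mult_right_mono) (auto simp: r_def)
    ultimately show "(norm (x k - J w))\<^sup>2
        \<le> (norm (x k - w))\<^sup>2 - m + (m + 2 * (M + norm w) * r k + (r k)\<^sup>2)"
      by (simp add: power2_eq_square algebra_simps)
  qed
  then have "J w = w" by (rule unique)
  then show thesis using that w min by blast
qed

text \<open>The weak limit is the asymptotic center w. If \<langle>x k - w, y\<rangle> stayed above some \<epsilon> > 0 along a
subsequence, then moving w slightly in direction y would come strictly closer to that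
subsequence, so the center w' of the subsequence would be asymptotically strictly closer
to it than w is. As w' is a fixed point as well, the distances from the full sequence to w and
to w' converge, hence have the same limits as along the subsequence, and w' would beat w for the
full sequence.\<close>

theorem weak_convergence_to_fixed_point:
  fixes x :: "nat \<Rightarrow> 'a::{real_inner, complete_space}"
  assumes nonexp: "\<And>y z. norm (J y - J z) \<le> norm (y - z)"
    and bdd: "bounded (range x)"
    and res: "(\<lambda>k. x k - J (x k)) \<longlonglongrightarrow> 0"
    and conv: "\<And>z. J z = z \<Longrightarrow> convergent (\<lambda>k. norm (x k - z))"
  shows "\<exists>z. J z = z \<and> weakly_converges_to x z"
proof -
  obtain w m where Jw: "J w = w" and w: "limsup_dist_sq_le x w m"
    and min: "\<And>y t. limsup_dist_sq_le x y t \<Longrightarrow> m \<le> t"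
    using asymptotic_center_fixed[OF nonexp bdd res] by blast
  obtain l where l: "(\<lambda>k. norm (x k - w)) \<longlonglongrightarrow> l"
    using conv[OF Jw] convergent_def by blast
  have "l\<^sup>2 \<le> m" using w limsup_dist_sq_le_of_tendsto[OF l] by simp
  have half: "\<forall>\<^sub>F k in sequentially. (x k - w) \<bullet> y < \<epsilon>" if "0 < \<epsilon>" for y \<epsilon>
  proof (rule ccontr)
    assume "\<not> ?thesis"
    then have "\<exists>\<^sub>F k in sequentially. \<epsilon> \<le> (x k - w) \<bullet> y"
      by (simp add: frequently_def not_le)
    then have inf: "infinite {k. \<epsilon> \<le> (x k - w) \<bullet> y}"
      by (simp add: frequently_cofinite flip: cofinite_eq_sequentially)
    define r where "r = enumerate {k. \<epsilon> \<le> (x k - w) \<bullet> y}"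
    have "strict_mono r" unfolding r_def using inf by (rule strict_mono_enumerate)
    have sub: "(f \<circ> r) \<longlonglongrightarrow> L" if "f \<longlonglongrightarrow> L" for f :: "nat \<Rightarrow> 'c::topological_space" and L
      using LIMSEQ_subseq_LIMSEQ[OF that \<open>strict_mono r\<close>] .
    have large: "\<epsilon> \<le> (x (r j) - w) \<bullet> y" for j
      using enumerate_in_set[OF inf] by (auto simp: r_def)
    have "bounded (range (x \<circ> r))"
      using bdd by (rule bounded_subset) auto
    moreover have "(\<lambda>j. (x \<circ> r) j - J ((x \<circ> r) j)) \<longlonglongrightarrow> 0"
      using sub[OF res] by (simp add: comp_def)
    ultimately obtain w' m' where Jw': "J w' = w'" and w': "limsup_dist_sq_le (x \<circ> r) w' m'"
      and min': "\<And>y t. limsup_dist_sq_le (x \<circ> r) y t \<Longrightarrow> m' \<le> t"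
      using asymptotic_center_fixed[OF nonexp] by blast
    obtain l' where l': "(\<lambda>k. norm (x k - w')) \<longlonglongrightarrow> l'"
      using conv[OF Jw'] convergent_def by blast
    have "m \<le> l'\<^sup>2"
      using min limsup_dist_sq_le_of_tendsto[OF l'] by blast
    have "(\<lambda>j. norm ((x \<circ> r) j - w')) \<longlonglongrightarrow> l'"
      using sub[OF l'] by (simp add: comp_def)
    then have "l'\<^sup>2 \<le> m'"
      using w' limsup_dist_sq_le_of_tendsto by blast
    \<comment> \<open>Small enough for s^2 \<parallel>y\<parallel>^2 to stay below 2 s \<epsilon>, the gain of moving from w to w + s y;
      the 1 covers y = 0.\<close>
    define s where "s = \<epsilon> / ((norm y)\<^sup>2 + 1)"
    have "0 < s" using \<open>0 < \<epsilon>\<close> unfolding s_def by (intro divide_pos_pos add_nonneg_pos) auto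
    have lr: "(\<lambda>j. norm ((x \<circ> r) j - w)) \<longlonglongrightarrow> l"
      using sub[OF l] by (simp add: comp_def)
    have "limsup_dist_sq_le (x \<circ> r) (w + s *\<^sub>R y) (l\<^sup>2 - 2 * s * \<epsilon> + s\<^sup>2 * (norm y)\<^sup>2)"
    proof (rule limsup_dist_sq_le_perturb[OF _ tendsto_const])
      show "limsup_dist_sq_le (x \<circ> r) w (l\<^sup>2)"
        by (simp add: limsup_dist_sq_le_of_tendsto[OF lr])
      fix j
      have "s * \<epsilon> \<le> s * ((x (r j) - w) \<bullet> y)"
        using large \<open>0 < s\<close> by simp
      moreover have "(norm (x (r j) - (w + s *\<^sub>R y)))\<^sup>2 = (norm (x (r j) - w))\<^sup>2
          - 2 * (s * ((x (r j) - w) \<bullet> y)) + s\<^sup>2 * (norm y)\<^sup>2"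
        by (simp add: power2_norm_eq_inner inner_commute algebra_simps power2_eq_square[of s])
      ultimately show "(norm ((x \<circ> r) j - (w + s *\<^sub>R y)))\<^sup>2 \<le> (norm ((x \<circ> r) j - w))\<^sup>2 - l\<^sup>2
          + (l\<^sup>2 - 2 * s * \<epsilon> + s\<^sup>2 * (norm y)\<^sup>2)"
        by simp
    qed
    then have "m' \<le> l\<^sup>2 - 2 * s * \<epsilon> + s\<^sup>2 * (norm y)\<^sup>2" by (rule min')
    moreover have "s\<^sup>2 * (norm y)\<^sup>2 < 2 * s * \<epsilon>"
    proof -
      have "s * ((norm y)\<^sup>2 + 1) = \<epsilon>"
        unfolding s_def using add_nonneg_pos[OF zero_le_power2[of "norm y"] zero_less_one] by simp
      then have "s * \<epsilon> = s\<^sup>2 * (norm y)\<^sup>2 + s\<^sup>2"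
        by (auto simp: power2_eq_square algebra_simps)
      moreover have "0 < s * \<epsilon>" "0 \<le> s\<^sup>2" using \<open>0 < s\<close> \<open>0 < \<epsilon>\<close> by auto
      ultimately show ?thesis by linarith
    qed
    ultimately show False
      using \<open>l\<^sup>2 \<le> m\<close> \<open>m \<le> l'\<^sup>2\<close> \<open>l'\<^sup>2 \<le> m'\<close> by linarith
  qed
  have "(\<lambda>k. x k \<bullet> y) \<longlonglongrightarrow> w \<bullet> y" for y
  proof (rule order_tendstoI)
    fix a assume "a < w \<bullet> y"
    then show "\<forall>\<^sub>F k in sequentially. a < x k \<bullet> y"
      using half[of "w \<bullet> y - a" "- y"] by (auto elim!: eventually_mono simp: inner_diff_left)
  next
    fix a assume "w \<bullet> y < a"
    then show "\<forall>\<^sub>F k in sequentially. x k \<bullet> y < a"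
      using half[of "a - w \<bullet> y" y] by (auto elim!: eventually_mono simp: inner_diff_left)
  qed
  then show ?thesis using Jw by (auto simp: weakly_converges_to_def)
qed

section \<open>Energy decrease along the iteration\<close>

text \<open>Although the perturbation involves the new energy, dividing by its square root shows that
the square roots grow by at most \<delta> k in each step. Hence E is bounded, the perturbation is
summable, and E corrected by the partial sums is decreasing and bounded below.\<close>

lemma perturbed_descent:
  fixes E b \<delta> :: "nat \<Rightarrow> real"
  assumes E: "\<And>k. 0 \<le> E k" and b: "\<And>k. 0 \<le> b k" and \<delta>: "\<And>k. 0 \<le> \<delta> k"
    and "summable \<delta>"
    and descent: "\<And>k. E (Suc k) + b k \<le> E k + \<delta> k * sqrt (E (Suc k))"
  shows "convergent E" and "b \<longlonglongrightarrow> 0"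
proof -
  define D where "D = suminf \<delta>"
  have partial: "sum \<delta> {..<k} \<le> D" for k
    unfolding D_def using \<open>summable \<delta>\<close> \<delta> by (intro sum_le_suminf) auto
  have step: "sqrt (E (Suc k)) \<le> sqrt (E k) + \<delta> k" for k
  proof (rule ccontr)
    let ?s = "sqrt (E k)" and ?s' = "sqrt (E (Suc k))"
    assume less: "\<not> ?thesis"
    have "0 \<le> ?s" using E by simp
    then have "0 < ?s'" using less \<delta>[of k] by linarith
    have "?s' * ?s' \<le> ?s * ?s + \<delta> k * ?s'"
      using descent[of k] b[of k] E by simp
    also have "\<dots> \<le> ?s' * ?s + \<delta> k * ?s'"
      using \<open>0 \<le> ?s\<close> less \<delta>[of k] by (intro add_right_mono mult_right_mono) linarith+
    also have "\<dots> = ?s' * (?s + \<delta> k)" by (simp add: algebra_simps)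
    also have "\<dots> < ?s' * ?s'" using less \<open>0 < ?s'\<close> by (intro mult_strict_left_mono) auto
    finally show False by simp
  qed
  have "sqrt (E k) \<le> sqrt (E 0) + sum \<delta> {..<k}" for k
  proof (induction k)
    case (Suc k)
    then show ?case using step[of k] by simp
  qed simp
  then have bound: "sqrt (E k) \<le> sqrt (E 0) + D" for k
    using partial[of k] by (meson add_left_mono order_trans)
  define K where "K = sqrt (E 0) + D"
  define F where "F k = E k - K * sum \<delta> {..<k} + sum b {..<k}" for k
  have "F (Suc k) \<le> F k" for k
  proof -
    have "\<delta> k * sqrt (E (Suc k)) \<le> \<delta> k * K"
      unfolding K_def using bound \<delta> by (intro mult_left_mono)
    then show ?thesis using descent[of k] by (simp add: F_def algebra_simps)
  qed
  then have "decseq F" by (rule decseq_SucI)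
  have "0 \<le> K" unfolding K_def using bound[of 0] E[of 0] real_sqrt_ge_zero order_trans by blast
  have lower: "sum b {..<k} - K * D \<le> F k" for k
    using mult_left_mono[OF partial[of k] \<open>0 \<le> K\<close>] E[of k] by (simp add: F_def)
  have "- (K * D) \<le> F k" for k
    using lower[of k] sum_nonneg[of "{..<k}" b] b by fastforce
  then have "convergent F"
    using decseq_convergent[OF \<open>decseq F\<close>] convergent_def by metis
  have "sum b {..<k} \<le> F 0 + K * D" for k
    using lower[of k] decseqD[OF \<open>decseq F\<close>, of 0 k] by linarith
  then have "summable b" using b by (intro summableI_nonneg_bounded)
  then show "b \<longlonglongrightarrow> 0" by (rule summable_LIMSEQ_zero)
  have "convergent (\<lambda>k. F k + K * sum \<delta> {..<k} - sum b {..<k})"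
    using \<open>convergent F\<close> \<open>summable b\<close> \<open>summable \<delta>\<close>
    unfolding summable_iff_convergent
    by (intro convergent_diff convergent_add convergent_mult convergent_const)
  then show "convergent E" by (simp add: F_def)
qed

text \<open>One step of the iteration, with p for the weight of the new Yosida value. Pairing the
equation with v' - z, the extrapolated part of v' contributes a nonnegative multiple of
\<langle>a' - a, x' - x\<rangle> and the term (1 - \<tau>) \<langle>a, x' - x\<rangle>, which is exactly what is needed to replace \<langle>a, x' - z\<rangle> by \<langle>a, x - z\<rangle>.\<close>

lemma contracting_step_energy:
  fixes z x x' v v' a a' g :: "'b::real_inner"
  assumes eq: "0 = p *\<^sub>R a' - ((1 - \<tau>) * p) *\<^sub>R a + (v' - v) + \<beta> *\<^sub>R (x' - x) + g"
    and v': "v' = x' + ((1 - \<tau>) / \<tau>) *\<^sub>R (x' - x)"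
    and \<tau>: "0 < \<tau>" "\<tau> < 1" and p: "0 \<le> p" and \<beta>: "0 \<le> \<beta>"
    and mono: "0 \<le> (a' - a) \<bullet> (x' - x)"
  shows "p * (a' \<bullet> (x' - z)) + (norm (v' - z))\<^sup>2 / 2 + \<beta> / 2 * (norm (x' - z))\<^sup>2
      + \<beta> / 2 * (norm (x' - x))\<^sup>2
    \<le> (1 - \<tau>) * p * (a \<bullet> (x - z)) + (norm (v - z))\<^sup>2 / 2 + \<beta> / 2 * (norm (x - z))\<^sup>2
      + norm g * norm (v' - z)"
proof -
  define q where "q = (1 - \<tau>) / \<tau>"
  have q: "0 \<le> q" "q * \<tau> = 1 - \<tau>" using \<tau> by (simp_all add: q_def)
  have v'z: "v' - z = (x' - z) + q *\<^sub>R (x' - x)" by (simp add: v' q_def)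
  have zero: "0 = p * ((a' - (1 - \<tau>) *\<^sub>R a) \<bullet> (v' - z)) + (v' - v) \<bullet> (v' - z)
      + \<beta> * ((x' - x) \<bullet> (v' - z)) + g \<bullet> (v' - z)"
    using arg_cong[OF eq, of "\<lambda>w. w \<bullet> (v' - z)"]
    by (simp add: inner_add_left inner_diff_left[of _ _ "v' - z"] algebra_simps
        del: inner_diff_right)
  have A: "(a' - (1 - \<tau>) *\<^sub>R a) \<bullet> (v' - z)
      = a' \<bullet> (x' - z) - (1 - \<tau>) * (a \<bullet> (x - z)) + q * ((a' - a) \<bullet> (x' - x))"
  proof -
    have "(a' - (1 - \<tau>) *\<^sub>R a) \<bullet> (v' - z) = a' \<bullet> (x' - z) - (1 - \<tau>) * (a \<bullet> (x - z))
        + q * ((a' - a) \<bullet> (x' - x)) + (q * \<tau> - (1 - \<tau>)) * (a \<bullet> (x' - x))"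
      unfolding v'z by (simp add: algebra_simps)
    then show ?thesis using q by simp
  qed
  \<comment> \<open>Kept opaque, so that rewriting does not expand or discard its nonnegativity.\<close>
  define N where "N = (norm (v' - v))\<^sup>2"
  have V: "(v' - v) \<bullet> (v' - z)
      = (norm (v' - z))\<^sup>2 / 2 - (norm (v - z))\<^sup>2 / 2 + N / 2"
    unfolding N_def by (simp add: power2_norm_eq_inner inner_commute algebra_simps
        add_divide_distrib diff_divide_distrib)
  have X: "(x' - x) \<bullet> (v' - z) = (norm (x' - z))\<^sup>2 / 2 - (norm (x - z))\<^sup>2 / 2
      + (norm (x' - x))\<^sup>2 / 2 + q * (norm (x' - x))\<^sup>2"
    unfolding v'z by (simp add: power2_norm_eq_inner inner_commute algebra_simps
        add_divide_distrib diff_divide_distrib)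
  have "- (g \<bullet> (v' - z)) \<le> norm g * norm (v' - z)"
    using Cauchy_Schwarz_ineq2[of g "v' - z"] by linarith
  moreover have "0 \<le> p * (q * ((a' - a) \<bullet> (x' - x)))" using p q mono by simp
  moreover have "0 \<le> \<beta> * (q * (norm (x' - x))\<^sup>2)" using \<beta> q by simp
  moreover have "0 \<le> N" by (simp add: N_def)
  ultimately show ?thesis
    using zero unfolding A V X by (simp add: algebra_simps)
qed

text \<open>The energy controls the distance of x k to z because \<beta> > 0. Since v k and x k merge, the
limit of the energy is (1 + \<beta>)/2 times the limit of the squared distance.\<close>

lemma contracting_ppa_fejer:
  fixes T :: "'a::{real_inner, complete_space} \<Rightarrow> 'a set"
    and c \<tau> \<eta> \<beta> :: real and \<delta> :: "nat \<Rightarrow> real" and g x :: "nat \<Rightarrow> 'a"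
  assumes T: "maximally_monotone T" and c: "0 < c"
    and \<tau>: "0 < \<tau>" "\<tau> < 1" and \<eta>: "0 < \<eta>" "\<eta> < 1" and \<beta>: "0 < \<beta>"
    and \<delta>: "\<And>k. 0 \<le> \<delta> k" "summable \<delta>"
    and ppa: "linear_contracting_ppa T c \<tau> \<eta> \<beta> \<delta> g x"
    and z: "0 \<in> T z"
  shows "bounded (range x)" and "(\<lambda>k. yosida c T (x k)) \<longlonglongrightarrow> 0"
    and "convergent (\<lambda>k. norm (x k - z))"
proof -
  define \<rho> where "\<rho> = 1 - \<eta> * \<tau>"
  define \<kappa> where "\<kappa> = (1 - \<tau>) / \<rho>"
  have "\<eta> * \<tau> < 1 * \<tau>" using \<eta> \<tau> by (intro mult_strict_right_mono)
  moreover have "0 < \<eta> * \<tau>" using \<eta> \<tau> by simp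
  ultimately have \<rho>: "0 < \<rho>" "\<rho> < 1" and "1 - \<tau> < \<rho>"
    using \<tau> unfolding \<rho>_def by linarith+
  then have \<kappa>: "\<kappa> < 1" by (simp add: \<kappa>_def)
  define a where "a k = yosida c T (x k)" for k
  define v where "v = ppa_v \<tau> x"
  define \<phi> where "\<phi> k = a k \<bullet> (x k - z) / \<rho> ^ k" for k
  define E where "E k = \<phi> k + (norm (v k - z))\<^sup>2 / 2 + \<beta> / 2 * (norm (x k - z))\<^sup>2" for k
  define b where "b k = (1 - \<kappa>) * \<phi> k + \<beta> / 2 * (norm (x (Suc k) - x k))\<^sup>2" for k
  have vSuc: "v (Suc k) = x (Suc k) + ((1 - \<tau>) / \<tau>) *\<^sub>R (x (Suc k) - x k)" for k
  proof -
    have "1 / \<tau> = 1 + (1 - \<tau>) / \<tau>" using \<tau> by (simp add: field_simps)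
    then show ?thesis by (simp add: v_def ppa_v_def algebra_simps)
  qed
  have "yosida c T z = 0"
    using resolvent_fixed_iff[OF T c, of z] z by (simp add: yosida_def)
  then have "c * (norm (a k))\<^sup>2 \<le> a k \<bullet> (x k - z)" for k
    using yosida_cocoercive[OF T c, of "x k" z] by (simp add: a_def)
  moreover have "c * (norm (a k))\<^sup>2 \<le> c * (norm (a k))\<^sup>2 / \<rho> ^ k" for k
    using c \<rho> by (simp add: field_simps mult_left_le_one_le power_le_one)
  ultimately have a_le: "c * (norm (a k))\<^sup>2 \<le> \<phi> k" for k
    using \<rho> unfolding \<phi>_def by (meson divide_right_mono less_imp_le order_trans zero_less_power)
  have \<phi>0: "0 \<le> \<phi> k" for k
    using a_le[of k] c by (meson less_imp_le mult_nonneg_nonneg order_trans zero_le_power2)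
  have E0: "0 \<le> E k" for k using \<phi>0 \<beta> by (simp add: E_def)
  have b0: "0 \<le> b k" for k using \<phi>0 \<beta> \<kappa> by (simp add: b_def)
  have descent: "E (Suc k) + b k \<le> E k + (sqrt 2 * \<delta> k) * sqrt (E (Suc k))" for k
  proof -
    let ?p = "1 / \<rho> ^ Suc k"
    have g: "norm (g k) \<le> \<delta> k"
      and eq: "0 = ?p *\<^sub>R a (Suc k) - ((1 - \<tau>) * ?p) *\<^sub>R a k + (v (Suc k) - v k)
        + \<beta> *\<^sub>R (x (Suc k) - x k) + g k"
      using ppa by (simp_all add: linear_contracting_ppa_def a_def v_def \<rho>_def)
    have "0 \<le> c * (norm (a (Suc k) - a k))\<^sup>2" using c by simp
    also have "\<dots> \<le> (a (Suc k) - a k) \<bullet> (x (Suc k) - x k)"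
      unfolding a_def by (rule yosida_cocoercive[OF T c])
    finally have "?p * (a (Suc k) \<bullet> (x (Suc k) - z)) + (norm (v (Suc k) - z))\<^sup>2 / 2
        + \<beta> / 2 * (norm (x (Suc k) - z))\<^sup>2 + \<beta> / 2 * (norm (x (Suc k) - x k))\<^sup>2
      \<le> (1 - \<tau>) * ?p * (a k \<bullet> (x k - z)) + (norm (v k - z))\<^sup>2 / 2
        + \<beta> / 2 * (norm (x k - z))\<^sup>2 + norm (g k) * norm (v (Suc k) - z)"
      using contracting_step_energy[OF eq vSuc \<tau>, of z] \<rho> \<beta> by simp
    moreover have "?p * (a (Suc k) \<bullet> (x (Suc k) - z)) = \<phi> (Suc k)"
      by (simp add: \<phi>_def)
    moreover have "(1 - \<tau>) * ?p * (a k \<bullet> (x k - z)) = \<kappa> * \<phi> k"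
      by (simp add: \<phi>_def \<kappa>_def)
    ultimately have "E (Suc k) + b k \<le> E k + norm (g k) * norm (v (Suc k) - z)"
      by (simp add: E_def b_def algebra_simps)
    moreover have "norm (g k) * norm (v (Suc k) - z) \<le> \<delta> k * sqrt (2 * E (Suc k))"
    proof (intro mult_mono)
      show "norm (v (Suc k) - z) \<le> sqrt (2 * E (Suc k))"
        using \<phi>0[of "Suc k"] \<beta> by (intro real_le_rsqrt) (simp add: E_def)
    qed (use g \<delta> in auto)
    ultimately show ?thesis by (simp add: real_sqrt_mult mult_ac)
  qed
  have "summable (\<lambda>k. sqrt 2 * \<delta> k)" using \<delta>(2) by (rule summable_mult)
  then have convE: "convergent E" and b_lim: "b \<longlonglongrightarrow> 0"
    using perturbed_descent[of E b "\<lambda>k. sqrt 2 * \<delta> k"] E0 b0 \<delta>(1) descent by auto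
  have "(\<lambda>k. (1 - \<kappa>) * \<phi> k) \<longlonglongrightarrow> 0"
    using \<phi>0 \<beta> \<kappa> by (intro tendsto_sandwich[OF _ _ tendsto_const b_lim]) (auto simp: b_def)
  then have \<phi>_lim: "\<phi> \<longlonglongrightarrow> 0"
    using \<kappa> tendsto_mult_left_iff[of "1 - \<kappa>" \<phi> 0] by simp
  have "(\<lambda>k. c * (norm (a k))\<^sup>2) \<longlonglongrightarrow> 0"
    using a_le c by (intro tendsto_sandwich[OF _ _ tendsto_const \<phi>_lim]) auto
  then have "(\<lambda>k. sqrt ((norm (a k))\<^sup>2)) \<longlonglongrightarrow> sqrt 0"
    using c tendsto_mult_left_iff[of c "\<lambda>k. (norm (a k))\<^sup>2" 0] by (intro tendsto_real_sqrt) simp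
  then show "(\<lambda>k. yosida c T (x k)) \<longlonglongrightarrow> 0"
    by (simp add: a_def tendsto_norm_zero_iff)
  have "(\<lambda>k. \<beta> / 2 * (norm (x (Suc k) - x k))\<^sup>2) \<longlonglongrightarrow> 0"
    using \<phi>0 \<beta> \<kappa> by (intro tendsto_sandwich[OF _ _ tendsto_const b_lim]) (auto simp: b_def)
  then have "(\<lambda>k. sqrt ((norm (x (Suc k) - x k))\<^sup>2)) \<longlonglongrightarrow> sqrt 0"
    using \<beta> tendsto_mult_left_iff[of "\<beta> / 2" "\<lambda>k. (norm (x (Suc k) - x k))\<^sup>2" 0]
    by (intro tendsto_real_sqrt) simp
  then have "(\<lambda>k. x (Suc k) - x k) \<longlonglongrightarrow> 0"
    by (simp add: tendsto_norm_zero_iff)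
  from tendsto_scaleR[OF tendsto_const[of "(1 - \<tau>) / \<tau>"] this]
  have "(\<lambda>k. v (Suc k) - x (Suc k)) \<longlonglongrightarrow> 0" by (simp add: vSuc)
  then have vx: "(\<lambda>k. v k - x k) \<longlonglongrightarrow> 0"
    by (subst (asm) filterlim_sequentially_Suc)
  obtain M where M: "\<And>k. E k \<le> M"
    using convergent_imp_Bseq[OF convE] E0 unfolding Bseq_def by auto
  have xz: "norm (x k - z) \<le> sqrt (2 / \<beta> * M)" for k
  proof (rule real_le_rsqrt)
    have "\<beta> / 2 * (norm (x k - z))\<^sup>2 \<le> M"
      using M[of k] \<phi>0[of k] zero_le_power2[of "norm (v k - z)"] unfolding E_def by linarith
    then show "(norm (x k - z))\<^sup>2 \<le> 2 / \<beta> * M" using \<beta> by (simp add: field_simps)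
  qed
  have "norm (x k) \<le> norm z + sqrt (2 / \<beta> * M)" for k
    using xz[of k] norm_triangle_ineq2[of "x k" z] by linarith
  then show "bounded (range x)" unfolding bounded_iff by auto
  define d where "d k = (norm (v k - x k))\<^sup>2 + 2 * ((v k - x k) \<bullet> (x k - z))" for k
  have "(\<lambda>k. (v k - x k) \<bullet> (x k - z)) \<longlonglongrightarrow> 0"
  proof (rule Lim_null_comparison)
    show "\<forall>\<^sub>F k in sequentially. norm ((v k - x k) \<bullet> (x k - z))
        \<le> norm (v k - x k) * sqrt (2 / \<beta> * M)"
    proof (intro always_eventually allI)
      fix k
      have "norm ((v k - x k) \<bullet> (x k - z)) \<le> norm (v k - x k) * norm (x k - z)"
        using Cauchy_Schwarz_ineq2[of "v k - x k" "x k - z"] by simp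
      also have "\<dots> \<le> norm (v k - x k) * sqrt (2 / \<beta> * M)"
        using xz by (intro mult_left_mono) auto
      finally show "norm ((v k - x k) \<bullet> (x k - z)) \<le> norm (v k - x k) * sqrt (2 / \<beta> * M)" .
    qed
    show "(\<lambda>k. norm (v k - x k) * sqrt (2 / \<beta> * M)) \<longlonglongrightarrow> 0"
      using tendsto_mult_right[OF tendsto_norm[OF vx], of "sqrt (2 / \<beta> * M)"] by simp
  qed
  then have "d \<longlonglongrightarrow> (norm (0::'a))\<^sup>2 + 2 * 0"
    unfolding d_def using vx by (intro tendsto_intros)
  then have "convergent d" by (rule convergentI)
  have "(norm (v k - z))\<^sup>2 = (norm (x k - z))\<^sup>2 + d k" for k
    by (simp add: d_def power2_norm_eq_inner inner_commute algebra_simps)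
  then have "(norm (x k - z))\<^sup>2 = 2 / (1 + \<beta>) * (E k - \<phi> k - 1 / 2 * d k)" for k
    using \<beta> by (simp add: E_def field_simps)
  moreover have "convergent (\<lambda>k. 2 / (1 + \<beta>) * (E k - \<phi> k - 1 / 2 * d k))"
    using convE convergentI[OF \<phi>_lim] \<open>convergent d\<close>
    by (intro convergent_mult convergent_diff convergent_const)
  ultimately have "convergent (\<lambda>k. (norm (x k - z))\<^sup>2)" by simp
  then obtain l where "(\<lambda>k. (norm (x k - z))\<^sup>2) \<longlonglongrightarrow> l" by (auto simp: convergent_def)
  from tendsto_real_sqrt[OF this] show "convergent (\<lambda>k. norm (x k - z))"
    by (auto intro: convergentI)
qed

theorem theorem7:
  fixes T :: "'a::{real_inner, complete_space} \<Rightarrow> 'a set"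
    and c \<tau> \<eta> \<beta> :: real
    and \<delta> :: "nat \<Rightarrow> real"
    and g x :: "nat \<Rightarrow> 'a"
  assumes "maximally_monotone T"
    and "inverse_operator T 0 \<noteq> {}"
    and "bounded (inverse_operator T 0)"
    and "0 < c"
    and "0 < \<tau>" and "\<tau> < 1"
    and "0 < \<eta>" and "\<eta> < 1"
    and "0 < \<beta>"
    and "\<And>k. 0 \<le> \<delta> k" and "summable \<delta>"
    and "linear_contracting_ppa T c \<tau> \<eta> \<beta> \<delta> g x"
  shows "\<exists>z. 0 \<in> T z \<and> weakly_converges_to x z"
proof -
  note fejer = contracting_ppa_fejer[OF assms(1,4-12)]
  obtain z0 where z0: "0 \<in> T z0"
    using assms(2) by (auto simp: inverse_operator_def)
  have "x k - resolvent c T (x k) = c *\<^sub>R yosida c T (x k)" for k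
    using \<open>0 < c\<close> by (simp add: yosida_def)
  then have residual: "(\<lambda>k. x k - resolvent c T (x k)) \<longlonglongrightarrow> 0"
    using tendsto_scaleR[OF tendsto_const[of c] fejer(2)[OF z0]] by simp
  have "\<exists>z. resolvent c T z = z \<and> weakly_converges_to x z"
    by (rule weak_convergence_to_fixed_point[OF
          resolvent_nonexpansive[OF assms(1,4)] fejer(1)[OF z0] residual])
      (simp add: resolvent_fixed_iff[OF assms(1,4)] fejer(3))
  then show ?thesis by (simp add: resolvent_fixed_iff[OF assms(1,4)])
qed

end
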